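(* Let $A\in\mathbb{R}^{m\times n}$ with $m\ge n$ have full column rank, and let $b\in\mathrm{range}(A)$. Let $W=(B^\top B)^{-1}\in\mathbb{R}^{n\times n}$, where $B^\top B\in\mathbb{R}^{n\times n}$ is nonsingular. Let $S_k\in\mathbb{R}^{m\times k}$, $k=1,\dots,n$, be sketching matrices with $\mathrm{rank}(S_k)=k$. Given $x_0\in\mathbb{R}^n$, let the sequence $\{x_k\}$ be computed by $$x_k=x_{k-1}+p_k,\qquad p_k=WA^\top S_k\,(S_k^\top A W A^\top S_k)^{-1}S_k^\top(b-Ax_{k-1}),\qquad k=1,\dots,n,$$ where the inverses are assumed to be well defined. Assume also that after $n$ iterations the matrix $S_n\in\mathbb{R}^{m\times n}$ has full rank and is in the range of $A$. Then $x_n$ solves $Ax=b$.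
   Context: All matrices and vectors are real. A matrix $S$ with $m$ rows is said to be in the range of $A$ if every column of $S$ lies in $\mathrm{range}(A)$. Since $W=(B^\top B)^{-1}$, $W$ is symmetric positive definite. *)

theory Defs
  imports
    "Jordan_Normal_Form.DL_Rank"
    "Jordan_Normal_Form.Gauss_Jordan_Elimination"
begin

definition mat_range :: "real mat \<Rightarrow> real vec set" where
  "mat_range A = (\<lambda>x. A *\<^sub>v x) ` carrier_vec (dim_col A)"

lemma mat_range_eq_col_space:
  assumes "A \<in> carrier_mat m n"
  shows "mat_range A = vec_space.col_space m A"
proof -
  have "A *\<^sub>v x \<in> carrier_vec (dim_row A)" for x
    by (rule carrier_vecI) (rule dim_mult_mat_vec)
  then show ?thesis
    unfolding vec_space.col_space_eq[OF assms] mat_range_def by blast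
qed

definition mat_in_range :: "real mat \<Rightarrow> real mat \<Rightarrow> bool" where
  "mat_in_range S A \<longleftrightarrow> dim_row S = dim_row A \<and> (\<forall>j < dim_col S. col S j \<in> mat_range A)"

(* Unspecified for matrices that are not invertible: every use has to be
   accompanied by an invertible_mat hypothesis. *)
definition mat_inv :: "real mat \<Rightarrow> real mat" where
  "mat_inv M = the (mat_inverse M)"

lemma mat_inv_carrier_inverse:
  assumes M: "M \<in> carrier_mat n n" and inv: "invertible_mat M"
  shows "mat_inv M \<in> carrier_mat n n" "M * mat_inv M = 1\<^sub>m n" "mat_inv M * M = 1\<^sub>m n"
proof -
  from inv obtain N where "inverts_mat M N" and "inverts_mat N M"
    unfolding invertible_mat_def by blast
  then have MN: "M * N = 1\<^sub>m n" and NM: "N * M = 1\<^sub>m (dim_row N)"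
    unfolding inverts_mat_def using carrier_matD(1)[OF M] by metis+
  have "dim_col N = n"
    using arg_cong[OF MN, of dim_col] by simp
  moreover have row: "dim_row N = n"
    using arg_cong[OF NM, of dim_col] carrier_matD(2)[OF M] by simp
  ultimately have "N \<in> carrier_mat n n"
    by (rule carrier_matI[rotated])
  then have "M \<in> Units (ring_mat TYPE(real) n ())"
    unfolding Units_def ring_mat_simps using M MN NM[unfolded row] by blast
  then obtain X where "mat_inverse M = Some X"
    using mat_inverse(1)[OF M, where b = "()"] by (cases "mat_inverse M") blast+
  then show "mat_inv M \<in> carrier_mat n n" "M * mat_inv M = 1\<^sub>m n" "mat_inv M * M = 1\<^sub>m n"
    using mat_inverse(2)[OF M] unfolding mat_inv_def by simp_all
qed

end

theory Submission
  imports Defs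
begin

text \<open>For \<open>k = n\<close> the sketched system is square: the invertible matrix
  \<open>S\<^sub>n\<^sup>T A W A\<^sup>T S\<^sub>n\<close> is the product of the square matrices \<open>C = S\<^sub>n\<^sup>T A\<close> and \<open>D = W A\<^sup>T S\<^sub>n\<close>.
  A right inverse of a square matrix is a left inverse, so \<open>D (C D)\<^sup>-\<^sup>1 C = 1\<close>. Writing \<open>b = A v\<close>,
  the last step therefore adds \<open>D (C D)\<^sup>-\<^sup>1 C (v - x\<^sub>n\<^sub>-\<^sub>1) = v - x\<^sub>n\<^sub>-\<^sub>1\<close>, whatever \<open>x\<^sub>n\<^sub>-\<^sub>1\<close> is.\<close>

lemma mult_mat_inv_mult_eq_one:
  assumes C: "C \<in> carrier_mat n n" and D: "D \<in> carrier_mat n n"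
    and inv: "invertible_mat (C * D)"
  shows "D * mat_inv (C * D) * C = 1\<^sub>m n"
proof -
  have CD: "C * D \<in> carrier_mat n n"
    using C D by simp
  note N = mat_inv_carrier_inverse[OF CD inv]
  have "C * (D * mat_inv (C * D)) = 1\<^sub>m n"
    using N(2) assoc_mult_mat[OF C D N(1)] by simp
  then show ?thesis
    by (rule mat_mult_left_right_inverse[OF C mult_carrier_mat[OF D N(1)]])
qed

text \<open>The residual factors as \<open>A *\<^sub>v (v - y)\<close>, so the update applies the
  identity \<open>D * mat_inv (C * D) * C\<close> to the error \<open>v - y\<close> and removes it
  in one step.\<close>

lemma square_sketch_step_eq:
  assumes A: "A \<in> carrier_mat m n" and W: "W \<in> carrier_mat n n" and S: "S \<in> carrier_mat m n"
    and inv: "invertible_mat (S\<^sup>T * A * W * A\<^sup>T * S)"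
    and y: "y \<in> carrier_vec n" and v: "v \<in> carrier_vec n"
  shows "y + (W * A\<^sup>T * S * mat_inv (S\<^sup>T * A * W * A\<^sup>T * S) * S\<^sup>T) *\<^sub>v (A *\<^sub>v v - A *\<^sub>v y) = v"
proof -
  define C where "C = S\<^sup>T * A"
  define D where "D = W * A\<^sup>T * S"
  have C: "C \<in> carrier_mat n n" and D: "D \<in> carrier_mat n n"
    using A W S by (auto simp: C_def D_def)
  have AT: "A\<^sup>T \<in> carrier_mat n m" and ST: "S\<^sup>T \<in> carrier_mat n m"
    using A S by auto
  \<comment> \<open>The left-nested product is regrouped so that it splits between \<open>A\<close>
    and \<open>W\<close>, where both factors are \<open>n\<close> by \<open>n\<close>.\<close>
  have "C * D = C * (W * A\<^sup>T) * S"
    unfolding D_def using assoc_mult_mat[OF C mult_carrier_mat[OF W AT] S] by simp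
  then have CD: "S\<^sup>T * A * W * A\<^sup>T * S = C * D"
    using assoc_mult_mat[OF C W AT] by (simp add: C_def)
  let ?N = "mat_inv (C * D)"
  have N: "?N \<in> carrier_mat n n"
    using mat_inv_carrier_inverse(1)[OF mult_carrier_mat[OF C D]] inv CD by simp
  have G: "D * ?N * S\<^sup>T \<in> carrier_mat n m"
    using D N ST by simp
  have "D * ?N * S\<^sup>T * A = D * ?N * C"
    unfolding C_def using assoc_mult_mat[OF mult_carrier_mat[OF D N] ST A] C_def by simp
  also have "\<dots> = 1\<^sub>m n"
    using mult_mat_inv_mult_eq_one[OF C D] inv CD by simp
  finally have GA: "D * ?N * S\<^sup>T * A = 1\<^sub>m n" .
  have "(D * ?N * S\<^sup>T) *\<^sub>v (A *\<^sub>v v - A *\<^sub>v y) = (D * ?N * S\<^sup>T * A) *\<^sub>v (v - y)"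
    using assoc_mult_mat_vec[OF G A, of "v - y"] v y
    by (simp add: mult_minus_distrib_mat_vec[OF A v y])
  also have "\<dots> = v - y"
    using GA v y by simp
  finally show ?thesis
    using v y unfolding CD D_def[symmetric] by auto
qed

theorem theorem3p1:
  fixes m n q :: nat
    and A B W :: "real mat"
    and b :: "real vec"
    and S :: "nat \<Rightarrow> real mat"
    and x p :: "nat \<Rightarrow> real vec"
  assumes "m \<ge> n"
    and "A \<in> carrier_mat m n"
    and "vec_space.rank m A = n"
    and "b \<in> mat_range A"
    and "B \<in> carrier_mat q n"
    and "invertible_mat (B\<^sup>T * B)"
    and "W = mat_inv (B\<^sup>T * B)"
    and "\<And>k. k \<in> {1..n} \<Longrightarrow> S k \<in> carrier_mat m k"
    and "\<And>k. k \<in> {1..n} \<Longrightarrow> vec_space.rank m (S k) = k"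
    and "x 0 \<in> carrier_vec n"
    and "\<And>k. k \<in> {1..n} \<Longrightarrow> invertible_mat ((S k)\<^sup>T * A * W * A\<^sup>T * S k)"
    and "\<And>k. k \<in> {1..n} \<Longrightarrow>
           p k = (W * A\<^sup>T * S k * mat_inv ((S k)\<^sup>T * A * W * A\<^sup>T * S k) * (S k)\<^sup>T)
                   *\<^sub>v (b - A *\<^sub>v x (k - 1))"
    and "\<And>k. k \<in> {1..n} \<Longrightarrow> x k = x (k - 1) + p k"
    and "vec_space.rank m (S n) = n"
    and "mat_in_range (S n) A"
  shows "x n \<in> carrier_vec n \<and> A *\<^sub>v x n = b"
proof -
  note A = \<open>A \<in> carrier_mat m n\<close>
  from \<open>b \<in> mat_range A\<close> obtain v where v: "v \<in> carrier_vec n" and b: "b = A *\<^sub>v v"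
    unfolding mat_range_def using A by auto
  have "B\<^sup>T * B \<in> carrier_mat n n"
    using \<open>B \<in> carrier_mat q n\<close> by simp
  then have W: "W \<in> carrier_mat n n"
    using mat_inv_carrier_inverse(1) assms(6,7) by simp
  have x: "x k \<in> carrier_vec n" if "k \<le> n" for k
    using that
  proof (induction k)
    case 0
    show ?case
      by (rule assms(10))
  next
    case (Suc k)
    then have k: "Suc k \<in> {1..n}" and xk: "x k \<in> carrier_vec n"
      by auto
    \<comment> \<open>A matrix-vector product has as many entries as its leftmost factor
      \<open>W\<close> has rows, and a vector sum takes its dimension from the second
      summand.\<close>
    have "dim_vec (p (Suc k)) = n"
      unfolding assms(12)[OF k] using W by simp
    then show ?case
      using xk assms(13)[OF k] by (auto intro: carrier_vecI)
  qed
  have "x n = v"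
  \<comment> \<open>For \<open>n = 0\<close> no update takes place, but \<open>carrier_vec 0\<close>
    contains only one vector.\<close>
  proof (cases "n = 0")
    case True
    then show ?thesis
      using x[of 0] v by auto
  next
    case False
    then have n: "n \<in> {1..n}"
      by simp
    show ?thesis
      \<comment> \<open>The last update starts from \<open>y = x (n - 1)\<close>.\<close>
      using square_sketch_step_eq[OF A W assms(8)[OF n] assms(11)[OF n] x[of "n - 1"] v]
      unfolding assms(13)[OF n] assms(12)[OF n] b by simp
  qed
  then show ?thesis
    using v b by simp
qed

end
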